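(* Let $Z_M(\sigma)$ be the partition function of Gaussian distributions on $M=\mathcal{P}_{\mathbb{C}}(N)$ and let $Z_{M^\vee}(\sigma)$ be the normalising constant of the $\Theta$ distributions on the dual symmetric space $M^\vee=\mathrm{U}(N)$. Then $$\frac{Z_M(\sigma)}{Z_{M^\vee}(\sigma)}=\exp\left[\Big(\frac{N^3-N}{6}\Big)\sigma^2\right].$$
   Context: $M=\mathcal{P}_{\mathbb{C}}(N)\cong\mathrm{GL}(N,\mathbb{C})/\mathrm{U}(N)$ is the space of positive definite Hermitian $N\times N$ matrices, whose partition function is $$Z_M(\sigma)=Z_2(\sigma)=\frac{\omega_2(N)}{2^{N^2}}(2\pi\sigma^2)^{\frac N2}\exp\Big((N^3-N)\frac{\sigma^2}{6}\Big)\prod_{k=1}^{N-1}\big(1-e^{-k\sigma^2}\big)^{N-k},$$ with $\omega_2(N)>0$ a constant independent of $\sigma$. Let $\vartheta(e^{i\phi}|\sigma^2)=\sum_{m=-\infty}^{+\infty}\exp(-m^2\sigma^2+2m\,i\phi)$ (Jacobi's $\vartheta$ function). For $x\in \mathrm{U}(N)$ written as $x=k\,\mathrm{diag}(e^{i\theta_1},\dots,e^{i\theta_N})\,k^\dagger$ with $k\in\mathrm{U}(N)$, set $$\Theta(x|\sigma^2)=k\,\mathrm{diag}\Big(\vartheta\big(e^{i\theta_1}\big|\tfrac{\sigma^2}{2}\big),\dots,\vartheta\big(e^{i\theta_N}\big|\tfrac{\sigma^2}{2}\big)\Big)k^\dagger .$$ For $x,\bar x\in\mathrm{U}(N)$ define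 $$f_*(x|\bar x,\sigma)=\det\Big[(2\pi\sigma^2)^{1/2}\,\Theta(x\bar x^\dagger|\sigma^2)\Big],\qquad Z_{M^\vee}(\sigma)=\int_{\mathrm{U}(N)}f_*(x|\bar x,\sigma)\,\mathrm{vol}(dx),$$ which does not depend on $\bar x$. Here $\mathrm{vol}(dx)$ is the invariant volume measure on $\mathrm{U}(N)$, for which the Weyl integral formula for functions $f$ of the eigenvalues $e^{i\theta_1},\dots,e^{i\theta_N}$ of $x$ reads $$\int_{\mathrm{U}(N)}f(x)\,\mathrm{vol}(dx)=\frac{\omega_2(N)}{2^{N^2}N!}\int_{[0,2\pi]^N}f(\theta_1,\dots,\theta_N)\prod_{i<j}|e^{i\theta_i}-e^{i\theta_j}|^2\,d\theta_1\cdots d\theta_N,$$ with the same constant $\omega_2(N)$. The $\Theta$ distribution $\Theta(\bar x,\sigma)$ is the probability distribution on $\mathrm{U}(N)$ with density $f_*(x|\bar x,\sigma)/Z_{M^\vee}(\sigma)$ with respect to $\mathrm{vol}(dx)$.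
   Formalization: As written the ratio is off by (2π)^N (see N=1) and fails for N=2 since ϑ at e^{iθ} has only even harmonics; here the Weyl formula uses dθ_j/(2π) for each angle, and Θ(x|σ²) uses ϑ(e^{iθ_j/2}|σ²/2) instead of ϑ(e^{iθ_j}|σ²/2). *)

theory Defs
  imports "HOL-Analysis.Analysis"
begin

definition adj :: "complex^'n^'n \<Rightarrow> complex^'n^'n" where
  "adj A = (\<chi> i j. cnj (A $ j $ i))"

definition unitary_group :: "(complex^'n^'n) set" where
  "unitary_group = {x. x ** adj x = mat 1 \<and> adj x ** x = mat 1}"

definition diag :: "('n \<Rightarrow> complex) \<Rightarrow> complex^'n^'n" where
  "diag d = (\<chi> i j. if i = j then d i else 0)"

text \<open>
  The partition function of Gaussian distributions on the space of positive definite Hermitian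
  \<open>N \<times> N\<close> matrices; \<open>\<omega>\<close> stands for the constant \<open>\<omega>\<^sub>2(N)\<close>.
\<close>

definition Z_M :: "nat \<Rightarrow> real \<Rightarrow> real \<Rightarrow> real" where
  "Z_M N \<omega> \<sigma> =
     \<omega> / 2 ^ (N\<^sup>2) * (2 * pi * \<sigma>\<^sup>2) powr (real N / 2)
     * exp ((real N ^ 3 - real N) * (\<sigma>\<^sup>2 / 6))
     * (\<Prod>k = 1..N - 1. (1 - exp (- real k * \<sigma>\<^sup>2)) ^ (N - k))"

text \<open>\<open>jacobi_theta \<phi> s\<close> is Jacobi's function, written \<open>\<vartheta>(e\<^bsup>i\<phi>\<^esup>|s)\<close>; it is \<open>\<pi>\<close>-periodic in \<open>\<phi>\<close>.\<close>

definition jacobi_theta :: "real \<Rightarrow> real \<Rightarrow> complex" where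
  "jacobi_theta \<phi> s =
     (\<Sum>\<^sub>\<infinity>m::int. exp (- (of_int m)\<^sup>2 * of_real s + 2 * of_int m * \<i> * of_real \<phi>))"

text \<open>
  The matrix function \<open>\<Theta>(x|s)\<close>. An eigenvalue \<open>e\<^bsup>i\<theta>\<^esup>\<close> of \<open>x\<close> is sent to
  \<open>\<Sum>m. exp (- m\<^sup>2 s / 2 + m i \<theta>)\<close>, the weight on the circle that belongs to the Rogers-Szego
  polynomials. With \<open>2 m i \<phi>\<close> in the series for \<open>\<vartheta>\<close> this is the half-angle argument
  \<open>\<phi> = \<theta> / 2\<close>; with \<open>\<phi> = \<theta>\<close> only even harmonics would appear, and the ratio of partition
  functions would not have the expected value from \<open>N = 2\<close> on.
\<close>

definition Theta :: "complex^'n^'n \<Rightarrow> real \<Rightarrow> complex^'n^'n" where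
  "Theta x s =
     (THE y. \<exists>k \<theta>. k \<in> unitary_group
        \<and> x = k ** diag (\<lambda>i. exp (\<i> * of_real (\<theta> i))) ** adj k
        \<and> y = k ** diag (\<lambda>i. jacobi_theta (\<theta> i / 2) (s / 2)) ** adj k)"

definition f_star :: "complex^'n^'n \<Rightarrow> complex^'n^'n \<Rightarrow> real \<Rightarrow> complex" where
  "f_star x xbar \<sigma> = det (sqrt (2 * pi * \<sigma>\<^sup>2) *\<^sub>R Theta (x ** adj xbar) (\<sigma>\<^sup>2))"

text \<open>
  The invariant measure on the unitary group, normalised through the Weyl integral formula. The
  angular measure is \<open>d\<theta> / (2 \<pi>)\<close> for each eigenvalue: with \<open>d\<theta>\<close> in its place,
  the normalising constant below, and hence the ratio of partition functions, would be off by the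
  factor \<open>(2 \<pi>)\<^sup>N\<close>, already for \<open>N = 1\<close>.
\<close>

definition weyl_integral_formula ::
    "real \<Rightarrow> (complex^('n::{finite,linorder})^('n::{finite,linorder})) measure \<Rightarrow> bool" where
  "weyl_integral_formula \<omega> vol \<longleftrightarrow>
     (\<forall>f (F :: ('n \<Rightarrow> real) \<Rightarrow> complex).
        integrable vol f \<longrightarrow>
        (\<forall>k\<in>unitary_group. \<forall>\<theta>.
           f (k ** diag (\<lambda>i. exp (\<i> * of_real (\<theta> i))) ** adj k) = F \<theta>) \<longrightarrow>
        (LINT x|vol. f x) =
          of_real (\<omega> / (2 ^ (CARD('n)\<^sup>2) * fact CARD('n) * (2 * pi) ^ CARD('n))) *
          (LINT \<theta> : PiE UNIV (\<lambda>_. {0..2 * pi}) | Pi\<^sub>M UNIV (\<lambda>_. lborel).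
             F \<theta> * of_real (\<Prod>i\<in>UNIV. \<Prod>j\<in>{j. i < j}.
               (cmod (exp (\<i> * of_real (\<theta> i)) - exp (\<i> * of_real (\<theta> j))))\<^sup>2)))"

definition invariant_volume ::
    "real \<Rightarrow> (complex^('n::{finite,linorder})^('n::{finite,linorder})) measure \<Rightarrow> bool" where
  "invariant_volume \<omega> vol \<longleftrightarrow>
     sets vol = sets (restrict_space borel unitary_group) \<and>
     finite_measure vol \<and>
     (\<forall>k\<in>unitary_group. distr vol vol (\<lambda>x. k ** x) = vol \<and> distr vol vol (\<lambda>x. x ** k) = vol) \<and>
     weyl_integral_formula \<omega> vol"

definition Z_dual :: "(complex^'n^'n) measure \<Rightarrow> complex^'n^'n \<Rightarrow> real \<Rightarrow> complex" where
  "Z_dual vol xbar \<sigma> = (LINT x|vol. f_star x xbar \<sigma>)"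

end

theory Submission
  imports Defs "HOL-Computational_Algebra.Fundamental_Theorem_Algebra"
begin

text \<open>
  Invariance of the volume removes \<open>xbar\<close>, and the Weyl formula turns the integral into one over
  angles, of a product of theta values against the squared modulus of a Vandermonde determinant.
  Expanding both determinants over permutations and integrating each angle separately (Andreief's
  identity) gives \<open>N! (2\<pi>)\<^sup>N\<close> times the Toeplitz determinant of the Fourier coefficients
  \<open>q\<^bsup>(a-b)\<^sup>2/2\<^esup>\<close>, where \<open>q = exp (-\<sigma>\<^sup>2)\<close>. Pulling \<open>q\<^bsup>a\<^sup>2/2\<^esup>\<close> and \<open>q\<^bsup>b\<^sup>2/2\<^esup>\<close> out of rows and
  columns leaves the Vandermonde determinant of the points \<open>q\<^bsup>-a\<^esup>\<close>, which evaluates to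
  \<open>\<Prod>k. (1 - q\<^bsup>k\<^esup>)\<^bsup>N-k\<^esup>\<close>.

  Since \<open>Theta\<close> is a definite description over diagonalizations, its measurability needs the
  spectral theorem for unitary matrices; it is then a pointwise limit of Laurent polynomials in \<open>x\<close>.
\<close>

section \<open>Diagonalization of unitary matrices\<close>

lemma adj_nth [simp]: "adj A $ i $ j = cnj (A $ j $ i)"
  by (simp add: adj_def)

lemma adj_adj [simp]: "adj (adj A) = A"
  by (simp add: vec_eq_iff)

lemma adj_mult: "adj (A ** B) = adj B ** adj A"
  by (simp add: vec_eq_iff matrix_matrix_mult_def mult.commute)

lemma unitary_groupD:
  assumes "k \<in> unitary_group"
  shows "k ** adj k = mat 1" "adj k ** k = mat 1"
  using assms by (auto simp: unitary_group_def)

lemma unitary_groupI: "adj k ** k = mat 1 \<Longrightarrow> k \<in> unitary_group"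
  by (simp add: unitary_group_def matrix_left_right_inverse)

lemma adj_in_unitary_group: "k \<in> unitary_group \<Longrightarrow> adj k \<in> unitary_group"
  by (simp add: unitary_group_def)

lemma mult_in_unitary_group:
  assumes "k \<in> unitary_group" "l \<in> unitary_group"
  shows "k ** l \<in> unitary_group"
proof (rule unitary_groupI)
  have "adj (k ** l) ** (k ** l) = adj l ** (adj k ** k) ** l"
    by (simp add: adj_mult matrix_mul_assoc)
  then show "adj (k ** l) ** (k ** l) = mat 1"
    by (simp add: unitary_groupD assms)
qed

lemma conj_diag_nth:
  "(k ** diag d ** adj k) $ a $ b = (\<Sum>j\<in>UNIV. k $ a $ j * d j * cnj (k $ b $ j))"
  by (simp add: matrix_matrix_mult_def diag_def if_distrib cong: if_cong)

section \<open>Eigenvectors inside invariant subspaces of a complex matrix\<close>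

definition poly_apply :: "complex^'n^'n \<Rightarrow> complex poly \<Rightarrow> complex^'n \<Rightarrow> complex^'n" where
  "poly_apply A p v = (\<Sum>i\<le>degree p. coeff p i *s ((*v) A ^^ i) v)"

lemma poly_apply_bound:
  assumes "degree p \<le> n"
  shows "poly_apply A p v = (\<Sum>i\<le>n. coeff p i *s ((*v) A ^^ i) v)"
  unfolding poly_apply_def using assms
  by (intro sum.mono_neutral_left) (auto simp: coeff_eq_0)

text \<open>Multiplying by X shifts the coefficients by one, which amounts to one more application
  of \<open>A\<close>. This turns a root of an annihilating polynomial into an eigenvalue
  equation.\<close>

lemma poly_apply_linear_factor:
  "poly_apply A ([:-c, 1:] * q) v = A *v poly_apply A q v - c *s poly_apply A q v"
proof -
  let ?n = "degree q"
  let ?u = "\<lambda>i. ((*v) A ^^ i) v"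
  have deg: "degree ([:-c, 1:] * q) \<le> Suc ?n"
    using degree_mult_le[of "[:-c, 1:]" q] by simp
  have "[:-c, 1:] * q = pCons 0 q - smult c q"
    by simp
  then have "poly_apply A ([:-c, 1:] * q) v
      = (\<Sum>i\<le>Suc ?n. coeff (pCons 0 q) i *s ?u i) - (\<Sum>i\<le>Suc ?n. (c * coeff q i) *s ?u i)"
    unfolding poly_apply_bound[OF deg]
    by (simp only: coeff_diff coeff_smult vec.scale_left_diff_distrib sum_subtractf)
  also have "(\<Sum>i\<le>Suc ?n. coeff (pCons 0 q) i *s ?u i) = A *v poly_apply A q v"
    by (simp only: sum.atMost_Suc_shift coeff_pCons_0 coeff_pCons_Suc poly_apply_def
        linear_sum[OF matrix_vector_mul_linear] vec.scale_zero_left funpow.simps o_apply add_0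
        vec.scale vec.linear_sum[OF matrix_vector_mul_linear_gen] vector_scalar_commute)
  also have "(\<Sum>i\<le>Suc ?n. (c * coeff q i) *s ?u i) = c *s poly_apply A q v"
    by (simp add: poly_apply_bound[of q "Suc ?n"] vec.scale_sum_right vec.scale_right_distrib coeff_eq_0)
  finally show ?thesis .
qed

text \<open>The N + 1 vectors v, A v, ..., A^N v of an N-dimensional space satisfy a linear
  relation; its coefficients are those of the polynomial.\<close>

lemma annihilating_poly_exists:
  fixes A :: "complex^'n^'n" and v :: "complex^'n"
  shows "\<exists>p. p \<noteq> 0 \<and> poly_apply A p v = 0"
proof -
  let ?u = "\<lambda>i. ((*v) A ^^ i) v" and ?N = "CARD('n)"
  have "\<exists>c. (\<exists>i\<le>?N. c i \<noteq> 0) \<and> (\<Sum>i\<le>?N. c i *s ?u i) = 0"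
  \<comment> \<open>\<open>vec.dependent\<close> speaks of sets and would miss a repeated iterate;
    two equal iterates give a relation with coefficients 1 and -1 directly.\<close>
  proof (cases "inj_on ?u {..?N}")
    case True
    have "vec.dependent (?u ` {..?N})"
    proof (rule ccontr)
      assume "\<not> vec.dependent (?u ` {..?N})"
      then have "card (?u ` {..?N}) \<le> vec.dim (UNIV :: (complex^'n) set)"
        by (intro vec.independent_card_le_dim) auto
      then show False
        using card_image[OF True] by (simp add: vec.dim_UNIV card_cart_basis)
    qed
    then obtain a where a: "\<exists>w\<in>?u ` {..?N}. a w \<noteq> 0" "(\<Sum>w\<in>?u ` {..?N}. a w *s w) = 0"
      by (subst (asm) vec.dependent_finite) auto
    from a(2) have "(\<Sum>i\<le>?N. a (?u i) *s ?u i) = 0"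
      by (subst (asm) sum.reindex[OF True]) simp
    with a(1) show ?thesis by (intro exI[of _ "\<lambda>i. a (?u i)"]) auto
  next
    case False
    then obtain i j where ij: "i \<le> ?N" "j \<le> ?N" "i \<noteq> j" "?u i = ?u j"
      by (auto simp: inj_on_def)
    let ?c = "\<lambda>l. if l = i then 1 else if l = j then -1 else (0::complex)"
    have "(\<Sum>l\<le>?N. ?c l *s ?u l) = (\<Sum>l\<in>{i,j}. ?c l *s ?u l)"
      using ij by (intro sum.mono_neutral_right) auto
    also have "\<dots> = 0" using ij by simp
    finally show ?thesis using ij by (intro exI[of _ ?c]) auto
  qed
  then obtain c where c: "\<exists>i\<le>?N. c i \<noteq> 0" "(\<Sum>i\<le>?N. c i *s ?u i) = 0" by blast
  define p where "p = (\<Sum>i\<le>?N. monom (c i) i)"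
  have cf: "coeff p i = (if i \<le> ?N then c i else 0)" for i
    by (simp add: p_def coeff_sum)
  have "degree p \<le> ?N"
    by (intro degree_le) (simp add: cf)
  then have "poly_apply A p v = 0"
    using c(2) by (simp add: poly_apply_bound cf)
  moreover have "p \<noteq> 0"
    using c(1) cf by (metis coeff_0)
  ultimately show ?thesis by blast
qed

lemma invariant_subspace_eigenvector:
  fixes A :: "complex^'n^'n"
  assumes W: "vec.subspace W" and inv: "\<And>w. w \<in> W \<Longrightarrow> A *v w \<in> W"
    and nz: "v \<in> W" "v \<noteq> 0"
  shows "\<exists>c. \<exists>w\<in>W. w \<noteq> 0 \<and> A *v w = c *s w"
proof -
  \<comment> \<open>Split a linear factor off an annihilating polynomial of least degree on \<open>W\<close>.\<close>
  define P where "P n \<longleftrightarrow> (\<exists>p w. p \<noteq> 0 \<and> degree p = n \<and> w \<in> W \<and> w \<noteq> 0 \<and> poly_apply A p w = 0)"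
    for n
  have "\<exists>n. P n"
    using annihilating_poly_exists[of A v] nz unfolding P_def by blast
  then have "P (LEAST n. P n)" by (rule LeastI_ex)
  then obtain p w where p: "p \<noteq> 0" "degree p = (LEAST n. P n)" "w \<in> W" "w \<noteq> 0"
    "poly_apply A p w = 0" unfolding P_def by blast
  have "degree p \<noteq> 0"
  proof
    assume "degree p = 0"
    then obtain a where "p = [:a:]" by (rule degree_eq_zeroE)
    with p show False by (simp add: poly_apply_def)
  qed
  then obtain c where "poly p c = 0"
    using fundamental_theorem_of_algebra[of p] by (auto simp: constant_degree)
  then obtain q where q: "p = [:-c, 1:] * q"
    by (metis poly_eq_0_iff_dvd dvdE)
  have "q \<noteq> 0" using p(1) q by auto
  then have "degree p = Suc (degree q)"
    unfolding q by (subst degree_mult_eq) auto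
  \<comment> \<open>The least degree is taken over all nonzero vectors of \<open>W\<close>, so
    \<open>q\<close> cannot annihilate \<open>w\<close>; the nonzero vector q(A) w is the
    eigenvector.\<close>
  then have "\<not> P (degree q)"
    using not_less_Least[of "degree q" P] p(2) by simp
  then have "poly_apply A q w \<noteq> 0"
    using \<open>q \<noteq> 0\<close> p(3,4) unfolding P_def by blast
  moreover have "poly_apply A q w \<in> W"
  proof -
    have "((*v) A ^^ i) w \<in> W" for i
      by (induction i) (use inv p(3) in auto)
    then show ?thesis unfolding poly_apply_def
      by (intro vec.subspace_sum[OF W] vec.subspace_scale[OF W])
  qed
  moreover have "A *v poly_apply A q w = c *s poly_apply A q w"
    using p(5) unfolding q poly_apply_linear_factor by simp
  ultimately show ?thesis by blast
qed

section \<open>The Hermitian form and orthonormal eigenvectors of a unitary matrix\<close>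

definition cip :: "complex^'n \<Rightarrow> complex^'n \<Rightarrow> complex" where
  "cip u v = (\<Sum>i\<in>UNIV. cnj (u $ i) * v $ i)"

lemma cip_add_right: "cip u (v + w) = cip u v + cip u w"
  by (simp add: cip_def algebra_simps sum.distrib)

lemma cip_scale_right: "cip u (c *s v) = c * cip u v"
  by (simp add: cip_def sum_distrib_left algebra_simps)

lemma cip_scale_left: "cip (c *s u) v = cnj c * cip u v"
  by (simp add: cip_def sum_distrib_left algebra_simps)

lemma cip_zero_right [simp]: "cip u 0 = 0"
  by (simp add: cip_def)

lemma cnj_cip: "cnj (cip u v) = cip v u"
  by (simp add: cip_def mult.commute)

lemma cip_adj: "cip u (A *v v) = cip (adj A *v u) v"
proof -
  have "cip u (A *v v) = (\<Sum>i\<in>UNIV. \<Sum>j\<in>UNIV. cnj (u $ i) * (A $ i $ j * v $ j))"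
    by (simp add: cip_def matrix_vector_mult_def sum_distrib_left)
  also have "\<dots> = (\<Sum>j\<in>UNIV. \<Sum>i\<in>UNIV. cnj (u $ i) * (A $ i $ j * v $ j))"
    by (rule sum.swap)
  also have "\<dots> = cip (adj A *v u) v"
    by (simp add: cip_def matrix_vector_mult_def sum_distrib_right sum_distrib_left mult_ac)
  finally show ?thesis .
qed

lemma cip_self: "cip u u = of_real ((norm u)\<^sup>2)"
proof -
  have "cip u u = of_real (\<Sum>i\<in>UNIV. (norm (u $ i))\<^sup>2)"
    unfolding cip_def of_real_sum
    by (intro sum.cong refl) (metis complex_norm_square mult.commute)
  then show ?thesis
    by (simp add: norm_vec_def L2_set_def sum_nonneg)
qed

text \<open>Since \<open>adj x\<close> inverts \<open>x\<close>, the form \<open>cip\<close> is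
  preserved, which forces |c| = 1; applying \<open>adj x\<close> to the eigenvalue equation then
  gives the eigenvalue 1/c, which is \<open>cnj c\<close>.\<close>

lemma unitary_eigenvector:
  assumes x: "x \<in> unitary_group" and v: "v \<noteq> 0" "x *v v = c *s v"
  shows "norm c = 1" "adj x *v v = cnj c *s v"
proof -
  have inv: "adj x *v (x *v v) = v"
    by (simp add: matrix_vector_mul_assoc unitary_groupD[OF x])
  have "cip v v = cip (x *v v) (x *v v)"
    by (simp add: cip_adj[of "x *v v"] inv)
  also have "\<dots> = c * cnj c * cip v v"
    by (simp add: v cip_scale_left cip_scale_right)
  finally have cc: "c * cnj c = 1"
    using v(1) by (simp add: cip_self)
  then show "norm c = 1"
    by (metis complex_norm_square norm_ge_zero of_real_eq_1_iff power2_eq_1_iff norm_one power2_eq_imp_eq one_power2)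
  have "v = c *s (adj x *v v)"
    using inv v(2) by (simp add: vector_scalar_commute)
  then have "cnj c *s v = (c * cnj c) *s (adj x *v v)"
    by (metis mult.commute vec.scale_scale)
  then show "adj x *v v = cnj c *s v"
    by (simp add: cc)
qed

text \<open>Induction on \<open>J\<close>: the eigenvectors already found are eigenvectors of
  \<open>adj x\<close> too, so their orthogonal complement is invariant under \<open>x\<close> and,
  while an index remains, contains a further eigenvector.\<close>

lemma unitary_orthonormal_eigenvectors:
  fixes x :: "complex^'n^'n" and J :: "'n set"
  assumes x: "x \<in> unitary_group"
  shows "\<exists>e c. (\<forall>i\<in>J. x *v e i = c i *s e i) \<and> (\<forall>i\<in>J. \<forall>j\<in>J. cip (e i) (e j) = (if i = j then 1 else 0))"
  using finite[of J]
proof (induction J rule: finite_induct)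
  case empty
  then show ?case by simp
next
  case (insert j J)
  then obtain e c where eig: "\<forall>i\<in>J. x *v e i = c i *s e i"
    and on: "\<forall>i\<in>J. \<forall>j\<in>J. cip (e i) (e j) = (if i = j then 1 else 0)" by blast
  define W where "W = {w. \<forall>i\<in>J. cip (e i) w = 0}"
  have sub: "vec.subspace W"
    by (auto simp: vec.subspace_def W_def cip_add_right cip_scale_right)
  have ne: "e i \<noteq> 0" if "i \<in> J" for i
    using on that by (metis cip_zero_right zero_neq_one)
  have inv: "x *v w \<in> W" if "w \<in> W" for w
  proof -
    have "adj x *v e i = cnj (c i) *s e i" if "i \<in> J" for i
      using unitary_eigenvector(2)[OF x ne] eig that by blast
    then show ?thesis
      using that by (simp add: W_def cip_adj cip_scale_left)
  qed
  \<comment> \<open>\<open>W\<close> is the kernel of \<open>B\<close>, which is nontrivial because row \<open>j\<close> of \<open>B\<close> vanishes.\<close>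
  define B :: "complex^'n^'n" where "B = (\<chi> i. if i \<in> J then (\<chi> l. cnj (e i $ l)) else 0)"
  have "row j B = 0"
    using insert.hyps by (simp add: row_def B_def vec_eq_iff)
  then have "det B = 0" by (rule det_zero_row)
  then have "\<not> (\<exists>C. C ** B = mat 1)"
    using invertible_det_nz[of B] invertible_left_inverse[of B] by blast
  then obtain w where w: "B *v w = 0" "w \<noteq> 0"
    unfolding matrix_left_invertible_ker by blast
  have "cip (e i) w = (B *v w) $ i" if "i \<in> J" for i
    using that by (simp add: cip_def B_def matrix_vector_mult_def)
  then have "w \<in> W" by (simp add: W_def w)
  then obtain d u where u: "u \<in> W" "u \<noteq> 0" "x *v u = d *s u"
    using invariant_subspace_eigenvector[OF sub inv] w(2) by blast
  define f where "f = of_real (inverse (norm u)) *s u"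
  have "x *v f = d *s f"
    using u(3) by (simp add: f_def vector_scalar_commute mult.commute)
  moreover have "cip f f = 1"
    using u(2) by (simp add: f_def cip_scale_left cip_scale_right cip_self[of u] power2_eq_square
        field_simps)
  ultimately have f: "x *v f = d *s f" "cip f f = 1" .
  have "f \<in> W" unfolding f_def by (rule vec.subspace_scale[OF sub u(1)])
  then have "cip (e i) f = 0" "cip f (e i) = 0" if "i \<in> J" for i
    using that cnj_cip[of "e i" f] by (auto simp: W_def)
  with f eig on insert.hyps show ?case
    by (intro exI[of _ "e(j := f)"] exI[of _ "c(j := d)"]) auto
qed

text \<open>The orthonormal eigenvectors become the columns of \<open>k\<close>; the eigenvalues lie
  on the unit circle and their arguments serve as angles.\<close>

lemma unitary_diagonalization:
  fixes x :: "complex^'n^'n"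
  assumes x: "x \<in> unitary_group"
  obtains k \<theta> where "k \<in> unitary_group" "x = k ** diag (\<lambda>i. exp (\<i> * of_real (\<theta> i))) ** adj k"
proof -
  obtain e :: "'n \<Rightarrow> complex^'n" and c
    where eig: "\<And>i. x *v e i = c i *s e i"
      and on: "\<And>i j. cip (e i) (e j) = (if i = j then 1 else 0)"
    using unitary_orthonormal_eigenvectors[OF x, of UNIV] by auto
  define k :: "complex^'n^'n" where "k = (\<chi> i j. e j $ i)"
  have "adj k ** k = mat 1"
    using on by (simp add: vec_eq_iff matrix_matrix_mult_def mat_def k_def cip_def)
  then have k: "k \<in> unitary_group" by (rule unitary_groupI)
  have "e i \<noteq> 0" for i
    using on[of i i] by (metis cip_zero_right zero_neq_one)
  then have "norm (c i) = 1" for i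
    using unitary_eigenvector(1)[OF x _ eig] by blast
  then have c: "c = (\<lambda>i. exp (\<i> * of_real (Arg2pi (c i))))"
    by (simp add: complex_norm_eq_1_exp)
  have "x ** k = k ** diag c"
    using eig by (simp add: vec_eq_iff matrix_matrix_mult_def matrix_vector_mult_def diag_def k_def
        if_distrib mult.commute cong: if_cong)
  then have "x ** k ** adj k = k ** diag c ** adj k" by simp
  then have "x = k ** diag c ** adj k"
    by (simp add: matrix_mul_assoc[symmetric] unitary_groupD[OF k])
  then have "x = k ** diag (\<lambda>i. exp (\<i> * of_real (Arg2pi (c i)))) ** adj k"
    using c by simp
  then show thesis by (rule that[OF k])
qed

section \<open>Theta functions of unitary matrices\<close>

text \<open>As n <= n^2, a geometric series dominates the terms of nonnegative index; the integers
  are the naturals together with their negatives.\<close>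

lemma summable_on_exp_neg_square:
  fixes s :: real
  assumes "s > 0"
  shows "(\<lambda>m::int. exp (- (of_int m)\<^sup>2 * s)) summable_on UNIV"
proof -
  let ?f = "\<lambda>m::int. exp (- (of_int m)\<^sup>2 * s)"
  have le: "exp (- (real n)\<^sup>2 * s) \<le> exp (-s) ^ n" for n
  proof -
    have "real n \<le> (real n)\<^sup>2"
      by (simp add: power2_eq_square flip: of_nat_mult)
    then have "real n * s \<le> (real n)\<^sup>2 * s"
      using assms by (intro mult_right_mono) auto
    then show ?thesis
      by (simp flip: exp_of_nat_mult)
  qed
  have "summable (\<lambda>n. norm (exp (- (real n)\<^sup>2 * s)))"
  proof (rule summable_comparison_test)
    show "\<exists>N. \<forall>n\<ge>N. norm (norm (exp (- (real n)\<^sup>2 * s))) \<le> exp (-s) ^ n"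
      using le by simp
    show "summable (\<lambda>n. exp (-s) ^ n)"
      using assms by (intro summable_geometric) simp
  qed
  then have nat: "(\<lambda>n::nat. exp (- (real n)\<^sup>2 * s)) summable_on UNIV"
    by (rule norm_summable_imp_summable_on)
  have "?f summable_on (range int)"
    by (subst summable_on_reindex) (use nat in \<open>auto simp: o_def\<close>)
  moreover have "?f summable_on (range (\<lambda>n. - int n))"
    by (subst summable_on_reindex) (use nat in \<open>auto simp: o_def inj_on_def\<close>)
  ultimately have "?f summable_on (range int \<union> range (\<lambda>n. - int n))"
    by (rule summable_on_union)
  moreover have "range int \<union> range (\<lambda>n. - int n) = UNIV"
    by (auto simp: image_iff) (metis int_cases2)
  ultimately show ?thesis by simp
qed

text \<open>Symmetric partial sums of the theta series as Laurent polynomials in z = e^(it). They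
  serve as approximations both for measurability and for termwise integration.\<close>

definition theta_trunc :: "nat \<Rightarrow> real \<Rightarrow> complex \<Rightarrow> complex" where
  "theta_trunc M s z = (\<Sum>m = -int M..int M. of_real (exp (- (of_int m)\<^sup>2 * s)) * z powi m)"

text \<open>The value of the theta series at angle 0, which bounds it uniformly on the unit
  circle.\<close>

definition theta_const :: "real \<Rightarrow> real" where
  "theta_const s = (\<Sum>\<^sub>\<infinity>m::int. exp (- (of_int m)\<^sup>2 * s))"

text \<open>With the half angle, the series sees \<open>t\<close> only through e^(it); this makes
  \<open>Theta\<close> independent of the chosen angles.\<close>

lemma jacobi_theta_half_eq:
  "jacobi_theta (t / 2) s =
     (\<Sum>\<^sub>\<infinity>m::int. of_real (exp (- (of_int m)\<^sup>2 * s)) * exp (\<i> * of_real t) powi m)"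
  unfolding jacobi_theta_def
proof (rule infsum_cong)
  fix m :: int
  have "exp (2 * of_int m * \<i> * of_real (t / 2)) = exp (\<i> * of_real t) powi m"
    by (simp add: exp_power_int mult_ac)
  moreover have "exp (- (of_int m)\<^sup>2 * of_real s) = complex_of_real (exp (- (of_int m)\<^sup>2 * s))"
    by (simp flip: exp_of_real)
  ultimately show "exp (- (of_int m)\<^sup>2 * of_real s + 2 * of_int m * \<i> * of_real (t / 2)) =
      complex_of_real (exp (- (of_int m)\<^sup>2 * s)) * exp (\<i> * of_real t) powi m"
    by (simp only: exp_add)
qed

lemma norm_theta_trunc_le:
  assumes "s > 0" "norm z = 1"
  shows "norm (theta_trunc M s z) \<le> theta_const s"
proof -
  have "norm (theta_trunc M s z) \<le> (\<Sum>m = -int M..int M. exp (- (of_int m)\<^sup>2 * s))"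
    unfolding theta_trunc_def using assms(2)
    by (intro sum_norm_le) (simp add: norm_mult norm_power_int)
  also have "\<dots> \<le> theta_const s"
    unfolding theta_const_def
    by (intro finite_sum_le_infsum summable_on_exp_neg_square assms) auto
  finally show ?thesis .
qed

text \<open>Absolute convergence gives the limit along all finite index sets, and the symmetric
  intervals eventually contain every finite set of integers.\<close>

lemma theta_trunc_tendsto:
  assumes "s > 0"
  shows "(\<lambda>M. theta_trunc M s (exp (\<i> * of_real t))) \<longlonglongrightarrow> jacobi_theta (t / 2) s"
proof -
  let ?g = "\<lambda>m::int. of_real (exp (- (of_int m)\<^sup>2 * s)) * exp (\<i> * of_real t) powi m"
  have "(\<lambda>m. norm (?g m)) summable_on UNIV"
    using summable_on_exp_neg_square[OF assms]
    by (simp add: norm_mult norm_power_int)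
  then have "?g summable_on UNIV"
    by (rule abs_summable_summable)
  then have "(?g has_sum jacobi_theta (t / 2) s) UNIV"
    unfolding jacobi_theta_half_eq by (rule has_sum_infsum)
  then have lim: "(sum ?g \<longlongrightarrow> jacobi_theta (t / 2) s) (finite_subsets_at_top UNIV)"
    by (simp add: has_sum_def)
  have "filterlim (\<lambda>M. {-int M..int M}) (finite_subsets_at_top UNIV) sequentially"
    unfolding filterlim_finite_subsets_at_top
  proof (intro allI impI)
    fix X :: "int set"
    assume X: "finite X \<and> X \<subseteq> UNIV"
    define B where "B = nat (\<Sum>x\<in>X. \<bar>x\<bar>)"
    have "\<bar>x\<bar> \<le> int B" if "x \<in> X" for x
      using member_le_sum[of x X abs] that X by (simp add: B_def sum_nonneg)
    then have "X \<subseteq> {-int M..int M}" if "M \<ge> B" for M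
      using that by fastforce
    then show "\<forall>\<^sub>F M in sequentially. finite {- int M..int M} \<and> X \<subseteq> {- int M..int M} \<and> {- int M..int M} \<subseteq> UNIV"
      by (auto simp: eventually_sequentially)
  qed
  from filterlim_compose[OF lim this] show ?thesis
    by (simp add: theta_trunc_def)
qed

lemma norm_jacobi_theta_le:
  assumes "s > 0"
  shows "norm (jacobi_theta (t / 2) s) \<le> theta_const s"
  using Lim_bounded[OF tendsto_norm[OF theta_trunc_tendsto[OF assms, of t]]] norm_theta_trunc_le[OF assms]
  by simp

section \<open>Functional calculus through diagonalizations\<close>

lemma mult_diag_nth: "(A ** diag h) $ i $ j = A $ i $ j * h j"
  by (simp add: matrix_matrix_mult_def diag_def if_distrib cong: if_cong)

lemma diag_mult_nth: "(diag h ** A) $ i $ j = h i * A $ i $ j"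
  by (simp add: matrix_matrix_mult_def diag_def if_distrib[of "\<lambda>x. x * y" for y] cong: if_cong)

text \<open>The matrix \<open>u = adj l ** k\<close> intertwines \<open>diag a\<close> and
  \<open>diag b\<close>, so its entry at (i, j) can be nonzero only where \<open>a j = b i\<close>,
  hence where \<open>c j = d i\<close>. Thus \<open>u\<close> intertwines \<open>diag c\<close> and
  \<open>diag d\<close> too.\<close>

lemma conj_diag_cong:
  assumes k: "k \<in> unitary_group" and l: "l \<in> unitary_group"
    and eq: "k ** diag a ** adj k = l ** diag b ** adj l"
    and val: "\<And>i j. a i = b j \<Longrightarrow> c i = d j"
  shows "k ** diag c ** adj k = l ** diag d ** adj l"
proof -
  define u where "u = adj l ** k"
  have "adj l ** (k ** diag a ** adj k) ** k = adj l ** (l ** diag b ** adj l) ** k"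
    using eq by simp
  then have "u ** diag a ** (adj k ** k) = (adj l ** l) ** diag b ** u"
    by (simp add: u_def matrix_mul_assoc)
  then have "u ** diag a = diag b ** u"
    by (simp add: unitary_groupD k l)
  then have "u $ i $ j * a j = b i * u $ i $ j" for i j
    by (metis mult_diag_nth diag_mult_nth)
  then have "u $ i $ j = 0 \<or> a j = b i" for i j
    by (metis mult.commute mult_cancel_left)
  then have "u $ i $ j * c j = d i * u $ i $ j" for i j
    using val by (metis mult.commute mult_zero_left)
  then have "u ** diag c = diag d ** u"
    by (simp add: vec_eq_iff mult_diag_nth diag_mult_nth)
  then have "l ** (u ** diag c) ** adj k = l ** (diag d ** u) ** adj k" by simp
  then have "(l ** adj l) ** k ** diag c ** adj k = l ** diag d ** adj l ** (k ** adj k)"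
    by (simp add: u_def matrix_mul_assoc)
  then show ?thesis by (simp add: unitary_groupD k l)
qed

text \<open>The definite description is met by any diagonalization: by \<open>conj_diag_cong\<close>
  the result is unique, since equal eigenvalues have equal theta values.\<close>

lemma Theta_conj_diag:
  assumes k: "k \<in> unitary_group"
  shows "Theta (k ** diag (\<lambda>i. exp (\<i> * of_real (\<theta> i))) ** adj k) s =
    k ** diag (\<lambda>i. jacobi_theta (\<theta> i / 2) (s / 2)) ** adj k"
  unfolding Theta_def
proof (rule the_equality)
  fix y
  assume "\<exists>l \<phi>. l \<in> unitary_group
    \<and> k ** diag (\<lambda>i. exp (\<i> * of_real (\<theta> i))) ** adj k = l ** diag (\<lambda>i. exp (\<i> * of_real (\<phi> i))) ** adj l
    \<and> y = l ** diag (\<lambda>i. jacobi_theta (\<phi> i / 2) (s / 2)) ** adj l"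
  then obtain l \<phi> where l: "l \<in> unitary_group"
    "k ** diag (\<lambda>i. exp (\<i> * of_real (\<theta> i))) ** adj k = l ** diag (\<lambda>i. exp (\<i> * of_real (\<phi> i))) ** adj l"
    and y: "y = l ** diag (\<lambda>i. jacobi_theta (\<phi> i / 2) (s / 2)) ** adj l"
    by blast
  show "y = k ** diag (\<lambda>i. jacobi_theta (\<theta> i / 2) (s / 2)) ** adj k"
    unfolding y by (rule conj_diag_cong[OF k l, symmetric]) (simp add: jacobi_theta_half_eq)
qed (use k in blast)

lemma det_conj_diag:
  assumes k: "k \<in> unitary_group"
  shows "det (c *\<^sub>R (k ** diag d ** adj k)) = (\<Prod>i\<in>UNIV. of_real c * d i)"
proof -
  have "c *\<^sub>R (k ** diag d ** adj k) = k ** diag (\<lambda>i. of_real c * d i) ** adj k"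
    unfolding vec_eq_iff vector_scaleR_component conj_diag_nth scaleR_sum_right
    by (simp add: scaleR_conv_of_real mult_ac)
  moreover have "det k * det (adj k) = 1"
    using unitary_groupD(1)[OF k] by (metis det_I det_mul)
  moreover have "det (diag h) = (\<Prod>i\<in>UNIV. h i)" for h :: "'a \<Rightarrow> complex"
    by (subst det_diagonal) (simp_all add: diag_def)
  ultimately show ?thesis
    by (simp add: det_mul algebra_simps)
qed

text \<open>Meant for unitary \<open>x\<close>, where \<open>adj x\<close> is the inverse.\<close>

definition matrix_powi :: "complex^'n^'n \<Rightarrow> int \<Rightarrow> complex^'n^'n" where
  "matrix_powi x m = (if m \<ge> 0 then ((**) x ^^ nat m) (mat 1) else ((**) (adj x) ^^ nat (- m)) (mat 1))"

section \<open>Integer powers of unitary matrices; measurability and boundedness of the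
  determinant\<close>

lemma conj_diag_pow:
  assumes "k \<in> unitary_group"
  shows "((**) (k ** diag d ** adj k) ^^ n) (mat 1) = k ** diag (\<lambda>i. d i ^ n) ** adj k"
proof (induction n)
  case 0
  have "diag (\<lambda>i::'a. 1) = mat 1" by (auto simp: diag_def mat_def vec_eq_iff)
  then show ?case by (simp add: unitary_groupD assms)
next
  case (Suc n)
  have "((**) (k ** diag d ** adj k) ^^ Suc n) (mat 1)
      = k ** diag d ** (adj k ** k) ** diag (\<lambda>i. d i ^ n) ** adj k"
    by (simp add: Suc matrix_mul_assoc)
  also have "\<dots> = k ** (diag d ** diag (\<lambda>i. d i ^ n)) ** adj k"
    by (simp add: unitary_groupD assms matrix_mul_assoc)
  also have "diag d ** diag (\<lambda>i. d i ^ n) = diag (\<lambda>i. d i ^ Suc n)"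
    by (simp add: vec_eq_iff diag_mult_nth) (simp add: diag_def)
  finally show ?case .
qed

text \<open>On the unit circle the conjugate is the inverse, so powers of \<open>adj x\<close>
  supply the negative exponents.\<close>

lemma conj_diag_powi:
  assumes "k \<in> unitary_group" and d: "\<And>i. norm (d i) = 1"
  shows "matrix_powi (k ** diag d ** adj k) m = k ** diag (\<lambda>i. d i powi m) ** adj k"
proof -
  have "cnj (d i) = inverse (d i)" for i
    using d[of i] by (simp add: inverse_complex_def complex_eq_iff cmod_def)
  moreover have "adj (diag d) = diag (\<lambda>i. cnj (d i))"
    by (auto simp: vec_eq_iff diag_def)
  ultimately have "adj (k ** diag d ** adj k) = k ** diag (\<lambda>i. inverse (d i)) ** adj k"
    by (simp add: adj_mult matrix_mul_assoc)
  then show ?thesis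
    by (auto simp: matrix_powi_def conj_diag_pow assms power_int_def)
qed

lemma continuous_on_matrix_powi [continuous_intros]:
  "continuous_on S (\<lambda>x :: complex^'a^'a. matrix_powi x m $ a $ b)"
proof -
  have pow: "continuous_on S (\<lambda>x. ((**) (f x) ^^ n) (mat 1) $ a $ b)"
    if "\<And>a b. continuous_on S (\<lambda>x. f x $ a $ b)" for f :: "complex^'a^'a \<Rightarrow> complex^'a^'a" and n a b
  proof (induction n arbitrary: a b)
    case (Suc n)
    then show ?case
      using that by (auto simp: matrix_matrix_mult_def intro!: continuous_on_sum continuous_on_mult)
  qed simp
  have "continuous_on S (\<lambda>x. ((**) x ^^ n) (mat 1) $ a $ b)" for n
    by (rule pow) (intro continuous_intros)
  moreover have "continuous_on S (\<lambda>x. ((**) (adj x) ^^ n) (mat 1) $ a $ b)" for n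
    by (rule pow) (auto intro!: continuous_intros)
  ultimately show ?thesis
    by (cases "m \<ge> 0") (simp_all add: matrix_powi_def)
qed

text \<open>Each truncation \<open>?T M\<close> has entries continuous in \<open>x\<close>. On a
  diagonalization it acts as \<open>theta_trunc\<close> on every eigenvalue, so the determinants
  converge as finite products of convergent factors.\<close>

lemma det_Theta_measurable:
  assumes s: "s > 0"
  shows "(\<lambda>x. det (c *\<^sub>R Theta x s)) \<in> borel_measurable (restrict_space borel unitary_group)"
proof (rule borel_measurable_LIMSEQ_metric)
  let ?T = "\<lambda>M x. \<Sum>m = -int M..int M. exp (- (of_int m)\<^sup>2 * (s/2)) *\<^sub>R matrix_powi x m"
  show "(\<lambda>x. det (c *\<^sub>R ?T M x)) \<in> borel_measurable (restrict_space borel unitary_group)" for M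
    by (intro borel_measurable_continuous_on_restrict)
      (auto simp: det_def scaleR_conv_of_real intro!: continuous_intros)
  fix x :: "complex^'a^'a"
  assume "x \<in> space (restrict_space borel unitary_group)"
  then have "x \<in> unitary_group" by (simp add: space_restrict_space)
  then obtain k \<theta> where k: "k \<in> unitary_group"
    and x: "x = k ** diag (\<lambda>i. exp (\<i> * of_real (\<theta> i))) ** adj k"
    by (rule unitary_diagonalization)
  have "?T M x = k ** diag (\<lambda>i. theta_trunc M (s/2) (exp (\<i> * of_real (\<theta> i)))) ** adj k" for M
  proof -
    have "?T M x $ a $ b = (k ** diag (\<lambda>i. theta_trunc M (s/2) (exp (\<i> * of_real (\<theta> i)))) ** adj k) $ a $ b" for a b
    proof -
      have "?T M x $ a $ b = (\<Sum>m = -int M..int M. \<Sum>j\<in>UNIV. k $ a $ j *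
          (of_real (exp (- (of_int m)\<^sup>2 * (s/2))) * exp (\<i> * of_real (\<theta> j)) powi m) * cnj (k $ b $ j))"
        unfolding x sum_component vector_scaleR_component
        by (simp add: conj_diag_powi[OF k] conj_diag_nth scaleR_conv_of_real sum_distrib_left mult_ac)
      also have "\<dots> = (\<Sum>j\<in>UNIV. \<Sum>m = -int M..int M. k $ a $ j *
          (of_real (exp (- (of_int m)\<^sup>2 * (s/2))) * exp (\<i> * of_real (\<theta> j)) powi m) * cnj (k $ b $ j))"
        by (rule sum.swap)
      finally show ?thesis
        by (simp only: conj_diag_nth theta_trunc_def sum_distrib_left sum_distrib_right)
    qed
    then show ?thesis by (simp add: vec_eq_iff del: sum_component vector_scaleR_component)
  qed
  then have T: "det (c *\<^sub>R ?T M x) = (\<Prod>i\<in>UNIV. of_real c * theta_trunc M (s/2) (exp (\<i> * of_real (\<theta> i))))" for M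
    by (simp only: det_conj_diag[OF k])
  have "det (c *\<^sub>R Theta x s) = (\<Prod>i\<in>UNIV. of_real c * jacobi_theta (\<theta> i / 2) (s/2))"
    by (simp only: x Theta_conj_diag[OF k] det_conj_diag[OF k])
  then show "(\<lambda>M. det (c *\<^sub>R ?T M x)) \<longlonglongrightarrow> det (c *\<^sub>R Theta x s)"
    unfolding T using s by (auto intro!: tendsto_intros theta_trunc_tendsto)
qed

text \<open>Together with finiteness of the volume, this bound yields the integrability that the
  Weyl formula asks for.\<close>

lemma norm_det_Theta_le:
  assumes s: "s > 0" and x: "x \<in> unitary_group"
  shows "norm (det (c *\<^sub>R Theta (x :: complex^'n^'n) s)) \<le> (\<bar>c\<bar> * theta_const (s/2)) ^ CARD('n)"
proof -
  obtain k \<theta> where k: "k \<in> unitary_group"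
    and x: "x = k ** diag (\<lambda>i. exp (\<i> * of_real (\<theta> i))) ** adj k"
    using x by (rule unitary_diagonalization)
  have "norm (det (c *\<^sub>R Theta x s)) = (\<Prod>i\<in>UNIV. \<bar>c\<bar> * norm (jacobi_theta (\<theta> i / 2) (s/2)))"
    by (simp only: x Theta_conj_diag[OF k] det_conj_diag[OF k] prod_norm[symmetric] norm_mult norm_of_real)
  also have "\<dots> \<le> (\<Prod>i\<in>(UNIV::'n set). \<bar>c\<bar> * theta_const (s/2))"
    using s by (intro prod_mono conjI mult_left_mono norm_jacobi_theta_le) auto
  finally show ?thesis by simp
qed

section \<open>Vandermonde and Gaussian Toeplitz determinants\<close>

text \<open>Numbers the index type from 0 to N - 1 along its order, so that indices can serve as
  exponents.\<close>

definition rk :: "'n::{finite,linorder} \<Rightarrow> nat" where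
  "rk i = card {j. j < i}"

lemma rk_less_iff [simp]: "rk i < rk j \<longleftrightarrow> i < j"
proof -
  have "rk i < rk j" if "i < j" for i j :: 'a
    unfolding rk_def using that by (intro psubset_card_mono) auto
  then show ?thesis
    by (metis less_asym linorder_neqE)
qed

lemma rk_eq_iff [simp]: "rk i = rk j \<longleftrightarrow> i = j"
  by (metis less_irrefl linorder_neqE rk_less_iff)

lemma rk_less_card: "rk (i :: 'n::{finite,linorder}) < CARD('n)"
  unfolding rk_def by (intro psubset_card_mono) auto

lemma bij_betw_rk: "bij_betw rk (UNIV :: 'n::{finite,linorder} set) {..<CARD('n)}"
proof -
  have inj: "inj (rk :: 'n \<Rightarrow> nat)" by (simp add: inj_on_def)
  have "range (rk :: 'n \<Rightarrow> nat) = {..<CARD('n)}"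
    using card_image[OF inj] rk_less_card by (intro card_subset_eq) auto
  with inj show ?thesis by (simp add: bij_betw_def)
qed

lemma image_rk_lessThan: "rk ` {l. l < i} = {..<rk i}"
proof -
  have "rk ` {l. l < i} \<subseteq> {..<rk i}" by auto
  moreover have "card (rk ` {l. l < i}) = card {..<rk i}"
    by (subst card_image) (simp_all add: inj_on_def, simp add: rk_def)
  ultimately show ?thesis by (intro card_subset_eq) auto
qed

text \<open>Strong induction on the rank: if p i < i, then \<open>p i\<close> is already a fixed
  point, so \<open>p\<close> takes the same value at \<open>i\<close> and at \<open>p i\<close>,
  against injectivity.\<close>

lemma permutes_le_imp_id:
  fixes p :: "'n::{finite,linorder} \<Rightarrow> 'n"
  assumes p: "p permutes UNIV" and le: "\<And>i. p i \<le> i"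
  shows "p = id"
proof -
  have "p i = i" for i
  proof (induction i rule: measure_induct_rule[where f = rk])
    case (less i)
    show ?case
    proof (rule ccontr)
      assume "p i \<noteq> i"
      then have "p (p i) = p i"
        using le[of i] less[of "p i"] by simp
      then show False
        using permutes_inj[OF p] \<open>p i \<noteq> i\<close> by (auto dest: injD)
    qed
  qed
  then show ?thesis by auto
qed

text \<open>By \<open>permutes_le_imp_id\<close>, every permutation but the identity moves some
  index up and so picks an entry above the diagonal.\<close>

lemma det_lower_triangular:
  fixes A :: "'a::comm_ring_1^('n::{finite,linorder})^('n::{finite,linorder})"
  assumes "\<And>i j. i < j \<Longrightarrow> A $ i $ j = 0"
  shows "det A = (\<Prod>i\<in>UNIV. A $ i $ i)"
proof -
  have "(\<Prod>i\<in>UNIV. A $ i $ p i) = 0" if p: "p permutes UNIV" "p \<noteq> id" for p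
  proof -
    obtain i where "i < p i"
      using permutes_le_imp_id[OF p(1)] p(2) by (meson leI)
    with assms show ?thesis by (intro prod_zero) auto
  qed
  then have "det A = (\<Sum>p\<in>{id}. of_int (sign p) * (\<Prod>i\<in>UNIV. A $ i $ p i))"
    unfolding det_def by (intro sum.mono_neutral_right) (auto simp: finite_permutations permutes_id)
  then show ?thesis by simp
qed

text \<open>Multiplying by the unitriangular matrix of coefficients of the monic polynomials
  \<open>P j\<close> with roots \<open>z l\<close>, \<open>l < j\<close>, makes the Vandermonde matrix triangular.\<close>

lemma det_Vandermonde:
  fixes z :: "'n::{finite,linorder} \<Rightarrow> 'a::idom"
  shows "det (\<chi> i j. z i ^ rk j) = (\<Prod>i\<in>UNIV. \<Prod>l\<in>{l. l < i}. z i - z l)"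
proof -
  define P where "P j = (\<Prod>l\<in>{l. l < j}. [:- z l, 1:])" for j
  have deg: "degree (P j) = rk j" for j
    unfolding P_def rk_def by (subst degree_prod_sum_eq) auto
  have monic: "coeff (P j) (rk j) = 1" for j
    using lead_coeff_prod[of "\<lambda>l. [:- z l, 1:]" "{l. l < j}"]
    by (simp add: deg flip: P_def)
  let ?V = "(\<chi> i j. z i ^ rk j) :: 'a^('n::{finite,linorder})^('n::{finite,linorder})"
  let ?U = "(\<chi> a j. coeff (P j) (rk a)) :: 'a^('n::{finite,linorder})^('n::{finite,linorder})"
  have entry: "(?V ** ?U) $ i $ j = (\<Prod>l\<in>{l. l < j}. z i - z l)" for i j
  proof -
    have "(?V ** ?U) $ i $ j = (\<Sum>a\<in>(UNIV :: 'n set). z i ^ rk a * coeff (P j) (rk a))"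
      by (simp add: matrix_matrix_mult_def)
    also have "\<dots> = (\<Sum>m<CARD('n). z i ^ m * coeff (P j) m)"
      by (rule sum.reindex_bij_betw[OF bij_betw_rk])
    also have "\<dots> = (\<Sum>m\<le>rk j. z i ^ m * coeff (P j) m)"
      using rk_less_card[of j] by (intro sum.mono_neutral_right) (auto simp: coeff_eq_0 deg)
    also have "\<dots> = poly (P j) (z i)"
      by (simp add: poly_altdef deg mult.commute)
    finally show ?thesis by (simp add: P_def poly_prod)
  qed
  have "det (transpose ?U) = (\<Prod>i\<in>UNIV. transpose ?U $ i $ i)"
    by (rule det_lower_triangular) (simp add: transpose_def coeff_eq_0 deg)
  then have "det ?U = 1"
    by (simp add: det_transpose) (simp add: transpose_def monic)
  then have "det ?V = det (?V ** ?U)" by (simp add: det_mul)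
  also have "\<dots> = (\<Prod>i\<in>UNIV. (?V ** ?U) $ i $ i)"
    \<comment> \<open>Above the diagonal \<open>z i\<close> is a root of \<open>P j\<close>: the
      factor with l = i vanishes.\<close>
    by (rule det_lower_triangular) (auto simp: entry intro!: prod_zero)
  finally show ?thesis by (simp only: entry)
qed

text \<open>The combinatorial half of Andreief's identity: the inner sum gives the determinant of
  \<open>?C\<close> with rows permuted by \<open>p\<close>, its sign cancels \<open>sign p\<close>,
  and N! equal terms remain.\<close>

lemma sum_sign_sign_prod:
  fixes c :: "'n::finite \<Rightarrow> 'n \<Rightarrow> 'a::{comm_ring_1,semiring_char_0}"
  shows "(\<Sum>p | p permutes UNIV. \<Sum>r | r permutes UNIV.
      of_int (sign p) * of_int (sign r) * (\<Prod>i\<in>UNIV. c (p i) (r i))) = fact CARD('n) * det (\<chi> a b. c a b)"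
    (is "?L = _ * det ?C")
proof -
  have "?L = (\<Sum>p | p permutes (UNIV :: 'n set). of_int (sign p) * det (\<chi> i. ?C $ p i))"
    by (simp add: det_def sum_distrib_left mult.assoc)
  also have "\<dots> = (\<Sum>p | p permutes (UNIV :: 'n set). det ?C)"
  proof (intro sum.cong refl)
    fix p :: "'n \<Rightarrow> 'n"
    assume "p \<in> {p. p permutes UNIV}"
    then have "det (\<chi> i. ?C $ p i) = of_int (sign p) * det ?C"
      by (intro det_permute_rows) simp
    then show "of_int (sign p) * det (\<chi> i. ?C $ p i) = det ?C"
      by (simp add: sign_def)
  qed
  also have "\<dots> = fact CARD('n) * det ?C"
    by (simp add: card_permutations)
  finally show ?thesis .
qed

text \<open>The difference b - a = k occurs N - k times among the pairs a < b < N; passing from N to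
  N + 1 adds each k from 1 to N once.\<close>

lemma prod_one_minus_power_triangle:
  fixes q :: "'a::comm_ring_1"
  shows "(\<Prod>b<N. \<Prod>a<b. 1 - q ^ (b - a)) = (\<Prod>k = 1..N - 1. (1 - q ^ k) ^ (N - k))"
proof (induction N)
  case (Suc N)
  have "(\<Prod>a<N. 1 - q ^ (N - a)) = (\<Prod>k = 1..N. 1 - q ^ k)"
    by (rule prod.reindex_bij_witness[of _ "\<lambda>k. N - k" "\<lambda>a. N - a"]) auto
  \<comment> \<open>The factor at k = N has exponent 0, so the range may end at N as well as at N -
    1.\<close>
  moreover have "(\<Prod>k = 1..N. (1 - q ^ k) ^ (N - k)) = (\<Prod>k = 1..N - 1. (1 - q ^ k) ^ (N - k))"
    by (cases N) simp_all
  moreover have "(\<Prod>k = 1..N. (1 - q ^ k) ^ (Suc N - k)) = (\<Prod>k = 1..N. (1 - q ^ k) ^ (N - k) * (1 - q ^ k))"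
    by (intro prod.cong refl) (simp add: Suc_diff_le mult.commute)
  ultimately show ?case
    by (simp add: Suc prod.distrib)
qed simp

text \<open>Expanding the square, -(a - b)^2 s = -a^2 s + 2 a b s - b^2 s, factors the matrix as D V
  D, where V is the Vandermonde matrix of the nodes exp (2 s a). In the application 2 s is the
  square of \<sigma>.\<close>

lemma det_gaussian_Toeplitz:
  fixes s :: real
  shows "det ((\<chi> a b. exp (- (real (rk a) - real (rk b))\<^sup>2 * s)) :: real^('n::{finite,linorder})^('n::{finite,linorder}))
    = (\<Prod>k = 1..CARD('n) - 1. (1 - exp (- real k * (2 * s))) ^ (CARD('n) - k))"
proof -
  let ?g = "\<lambda>a::'n. exp (- (real (rk a))\<^sup>2 * s)"
  let ?z = "\<lambda>a::'n. exp (2 * s * real (rk a))"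
  let ?V = "(\<chi> a b. ?z a ^ rk b) :: real^('n::{finite,linorder})^('n::{finite,linorder})"
  let ?D = "(\<chi> a b. if a = b then ?g a else 0) :: real^('n::{finite,linorder})^('n::{finite,linorder})"
  have detD: "det ?D = (\<Prod>a\<in>UNIV. ?g a)"
    by (subst det_diagonal) auto
  have "?D ** ?V ** ?D = (\<chi> a b. exp (- (real (rk a) - real (rk b))\<^sup>2 * s))"
  proof -
    have "(?D ** ?V ** ?D) $ a $ b = ?g a * ?z a ^ rk b * ?g b" for a b
      by (simp add: matrix_matrix_mult_def if_distrib[of "\<lambda>x. x * y" for y]
          if_distrib[of "\<lambda>x. y * x" for y] cong: if_cong)
    moreover have "?g a * ?z a ^ rk b * ?g b = exp (- (real (rk a) - real (rk b))\<^sup>2 * s)" for a b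
      by (simp add: power2_eq_square algebra_simps flip: exp_of_nat_mult exp_add)
    ultimately show ?thesis by (simp add: vec_eq_iff)
  qed
  then have "det ((\<chi> a b. exp (- (real (rk a) - real (rk b))\<^sup>2 * s)) :: real^('n::{finite,linorder})^('n::{finite,linorder})) = det ?D * det ?V * det ?D"
    by (simp only: det_mul[symmetric])
  also have "\<dots> = (\<Prod>i\<in>UNIV. ?g i * ?g i * (\<Prod>l\<in>{l. l < i}. ?z i - ?z l))"
    by (simp add: detD det_Vandermonde prod.distrib mult_ac)
  also have "\<dots> = (\<Prod>i\<in>(UNIV :: 'n set). \<Prod>l\<in>{l. l < i}. 1 - exp (- 2 * s) ^ (rk i - rk l))"
  proof (intro prod.cong refl)
    fix i :: 'n
    have "?z i - ?z l = ?z i * (1 - exp (- 2 * s) ^ (rk i - rk l))" if "l < i" for l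
    proof -
      have "real (rk i - rk l) = real (rk i) - real (rk l)"
        using that by (simp add: of_nat_diff less_imp_le)
      then show ?thesis
        by (simp add: algebra_simps flip: exp_of_nat_mult exp_add)
    qed
    then have "(\<Prod>l\<in>{l. l < i}. ?z i - ?z l) = ?z i ^ rk i * (\<Prod>l\<in>{l. l < i}. 1 - exp (- 2 * s) ^ (rk i - rk l))"
      by (simp add: prod.distrib flip: rk_def cong: prod.cong_simp)
    \<comment> \<open>Pulling \<open>?z i\<close> out of each of the \<open>rk i\<close> differences
      gives exp (2 s r^2) with r = \<open>rk i\<close>, which cancels the two Gaussian
      factors.\<close>
    moreover have "?g i * ?g i * ?z i ^ rk i = 1"
      by (simp add: power2_eq_square algebra_simps flip: exp_of_nat_mult exp_add)
    ultimately show "?g i * ?g i * (\<Prod>l\<in>{l. l < i}. ?z i - ?z l) = (\<Prod>l\<in>{l. l < i}. 1 - exp (- 2 * s) ^ (rk i - rk l))"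
      by (simp only: mult.assoc[symmetric] mult_1_left)
  qed
  also have "\<dots> = (\<Prod>i\<in>(UNIV::'n set). \<Prod>a<rk i. 1 - exp (- 2 * s) ^ (rk i - a))"
  proof (intro prod.cong refl)
    fix i :: 'n
    have "bij_betw rk {l. l < i} {..<rk i}"
      by (auto simp: bij_betw_def image_rk_lessThan inj_on_def)
    then show "(\<Prod>l\<in>{l. l < i}. 1 - exp (- 2 * s) ^ (rk i - rk l)) = (\<Prod>a<rk i. 1 - exp (- 2 * s) ^ (rk i - a))"
      by (rule prod.reindex_bij_betw)
  qed
  also have "\<dots> = (\<Prod>b<CARD('n). \<Prod>a<b. 1 - exp (- 2 * s) ^ (b - a))"
    by (rule prod.reindex_bij_betw[OF bij_betw_rk])
  also have "\<dots> = (\<Prod>k = 1..CARD('n) - 1. (1 - exp (- real k * (2 * s))) ^ (CARD('n) - k))"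
    unfolding prod_one_minus_power_triangle
    by (intro prod.cong refl) (simp add: mult_ac flip: exp_of_nat_mult)
  finally show ?thesis .
qed

section \<open>The integral over eigenvalue angles\<close>

text \<open>Orthogonality of characters: for nonzero n the antiderivative takes equal values at 0
  and 2 pi.\<close>

lemma has_bochner_integral_exp_int:
  "has_bochner_integral lborel (\<lambda>t. indicator {0..2 * pi} t *\<^sub>R (exp (\<i> * of_real t) powi n))
     (if n = 0 then 2 * of_real pi else 0 :: complex)"
proof (cases "n = 0")
  case True
  have "(complex_of_real has_vector_derivative 1) (at t within {0..2 * pi})" for t
    unfolding has_vector_derivative_def scaleR_conv_of_real
    using bounded_linear_imp_has_derivative[OF bounded_linear_of_real] by simp
  then show ?thesis
    using has_bochner_integral_FTC_Icc[of 0 "2 * pi" complex_of_real "\<lambda>_. 1"] True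
    by simp
next
  case False
  let ?F = "\<lambda>t::real. exp (\<i> * of_int n * of_real t) / (\<i> * of_int n)"
  let ?f = "\<lambda>t::real. exp (\<i> * of_int n * of_real t)"
  have "((\<lambda>z. exp (\<i> * of_int n * z) / (\<i> * of_int n)) has_field_derivative ?f t)
     (at (of_real t))" for t
    using False by (auto intro!: derivative_eq_intros)
  then have "(?F has_vector_derivative ?f t) (at t within {0..2 * pi})" for t
    by (intro has_vector_derivative_real_field) (auto intro: has_field_derivative_at_within)
  then have "has_bochner_integral lborel (\<lambda>t. indicator {0..2 * pi} t *\<^sub>R ?f t) (?F (2 * pi) - ?F 0)"
    by (intro has_bochner_integral_FTC_Icc) (auto intro!: continuous_intros)
  moreover have "?F (2 * pi) = ?F 0"
    using exp_integer_2pi[of "of_int n"] by (simp add: mult_ac)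
  ultimately show ?thesis
    using False by (simp add: exp_power_int mult_ac)
qed

text \<open>The cutoff to [0, 2 pi] is built in so that the integrand over the box becomes a sum of
  products of one-variable functions. The exponents \<open>a\<close> and \<open>b\<close> come from
  the Vandermonde determinant and its conjugate.\<close>

definition weighted_monomial :: "real \<Rightarrow> nat \<Rightarrow> nat \<Rightarrow> real \<Rightarrow> complex" where
  "weighted_monomial s a b t = indicator {0..2 * pi} t *\<^sub>R
     (jacobi_theta (t / 2) s * (exp (\<i> * of_real t) ^ a * cnj (exp (\<i> * of_real t)) ^ b))"

lemma exp_i_power_mult_cnj_power:
  "exp (\<i> * of_real t) ^ a * cnj (exp (\<i> * of_real t)) ^ b = exp (\<i> * of_real t) powi (int a - int b)"
  by (simp add: exp_cnj exp_power_int algebra_simps flip: exp_of_nat_mult exp_add exp_minus)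

text \<open>The integral extracts the Fourier coefficient of theta at b - a. Truncations are
  integrated term by term; dominated convergence, with \<open>theta_const s\<close> on the bounded
  interval, passes to the limit.\<close>

lemma
  assumes s: "s > 0"
  shows integrable_weighted_monomial: "integrable lborel (weighted_monomial s a b)"
    and integral_weighted_monomial:
      "(LINT t|lborel. weighted_monomial s a b t) = of_real (2 * pi * exp (- (real a - real b)\<^sup>2 * s))"
proof -
  define d where "d = int a - int b"
  let ?E = "\<lambda>t::real. exp (\<i> * of_real t)"
  let ?S = "\<lambda>M t. indicator {0..2 * pi} t *\<^sub>R (theta_trunc M s (?E t) * ?E t powi d)"
  let ?w = "\<lambda>t::real. indicator {0..2 * pi} t *\<^sub>R theta_const s"
  have wm: "weighted_monomial s a b = (\<lambda>t. indicator {0..2 * pi} t *\<^sub>R (jacobi_theta (t / 2) s * ?E t powi d))"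
    by (simp add: weighted_monomial_def exp_i_power_mult_cnj_power d_def fun_eq_iff)
  have S: "has_bochner_integral lborel (?S M)
      (\<Sum>m = -int M..int M. of_real (exp (- (of_int m)\<^sup>2 * s)) * (if m + d = 0 then 2 * of_real pi else 0))" for M
  proof -
    have "?S M t = (\<Sum>m = -int M..int M. of_real (exp (- (of_int m)\<^sup>2 * s)) *
        (indicator {0..2 * pi} t *\<^sub>R (?E t powi (m + d))))" for t
      by (cases "t \<in> {0..2 * pi}")
        (simp_all add: theta_trunc_def sum_distrib_left power_int_add mult_ac)
    then show ?thesis
      by (simp only:) (intro has_bochner_integral_sum has_bochner_integral_mult_right has_bochner_integral_exp_int)
  qed
  then have Smeas: "?S M \<in> borel_measurable lborel" for M
    by (rule borel_measurable_has_bochner_integral)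
  have lim: "(\<lambda>M. ?S M t) \<longlonglongrightarrow> weighted_monomial s a b t" for t
    unfolding wm by (intro tendsto_intros theta_trunc_tendsto s)
  have meas: "weighted_monomial s a b \<in> borel_measurable lborel"
    by (rule borel_measurable_LIMSEQ_metric[OF Smeas lim])
  have w: "integrable lborel ?w" by simp
  have bound: "norm (?S M t) \<le> ?w t" for M t
    using norm_theta_trunc_le[OF s, of "?E t" M]
    by (auto simp: norm_mult norm_power_int indicator_def)
  show "integrable lborel (weighted_monomial s a b)"
    by (rule integrable_dominated_convergence[where s = ?S, OF meas Smeas w AE_I2[OF lim] AE_I2[OF bound]])
  have "(\<lambda>M. LINT t|lborel. ?S M t) \<longlonglongrightarrow> (LINT t|lborel. weighted_monomial s a b t)"
    by (rule integral_dominated_convergence[where s = ?S, OF meas Smeas w AE_I2[OF lim] AE_I2[OF bound]])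
  \<comment> \<open>From M = |d| on, the only surviving index -d lies in the range, and the integral
    no longer depends on M.\<close>
  moreover have "(LINT t|lborel. ?S M t) = of_real (2 * pi * exp (- (real a - real b)\<^sup>2 * s))"
    if "M \<ge> nat \<bar>d\<bar>" for M
  proof -
    have "(LINT t|lborel. ?S M t) =
        (\<Sum>m = -int M..int M. of_real (exp (- (of_int m)\<^sup>2 * s)) * (if m + d = 0 then 2 * of_real pi else 0))"
      by (rule has_bochner_integral_integral_eq[OF S])
    also have "\<dots> = (\<Sum>m\<in>{-d}. of_real (exp (- (of_int m)\<^sup>2 * s)) * (if m + d = 0 then 2 * of_real pi else 0))"
      using that by (intro sum.mono_neutral_right) auto
    also have "\<dots> = of_real (2 * pi * exp (- (real a - real b)\<^sup>2 * s))"
      by (simp add: d_def power2_commute)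
    finally show ?thesis .
  qed
  then have "(\<lambda>M. LINT t|lborel. ?S M t) \<longlonglongrightarrow> of_real (2 * pi * exp (- (real a - real b)\<^sup>2 * s))"
    by (intro tendsto_eventually) (auto simp: eventually_sequentially)
  ultimately show "(LINT t|lborel. weighted_monomial s a b t) = of_real (2 * pi * exp (- (real a - real b)\<^sup>2 * s))"
    by (rule LIMSEQ_unique)
qed

text \<open>Splits the eigenvalue weight into a determinant and its conjugate, each of which expands
  over permutations.\<close>

lemma prod_dist_eq_Vandermonde:
  fixes z :: "'n::{finite,linorder} \<Rightarrow> complex"
  shows "of_real (\<Prod>i\<in>UNIV. \<Prod>j\<in>{j. i < j}. (cmod (z i - z j))\<^sup>2) =
    det (\<chi> i j. z i ^ rk j) * cnj (det (\<chi> i j. z i ^ rk j))"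
proof -
  have "(\<Prod>i\<in>UNIV. \<Prod>j\<in>{j. i < j}. (cmod (z i - z j))\<^sup>2) = (\<Prod>i\<in>UNIV. \<Prod>j\<in>{j. j < i}. (cmod (z i - z j))\<^sup>2)"
    by (simp add: prod.Sigma)
      (rule prod.reindex_bij_witness[of _ prod.swap prod.swap]; auto simp: norm_minus_commute)
  also have "\<dots> = (cmod (det (\<chi> i j. z i ^ rk j)))\<^sup>2"
    by (simp add: det_Vandermonde prod_norm[symmetric] prod_power_distrib)
  finally show ?thesis
    by (simp only: complex_norm_square)
qed

text \<open>Here N! counts the equal terms in Andreief's identity and (2 pi)^N comes from the N
  angular integrals; both cancel against the constant in
  \<open>weyl_integral_formula\<close>.\<close>

lemma weyl_integral_theta:
  fixes c s :: real
  assumes s: "s > 0"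
  shows "(LINT \<theta> : PiE (UNIV :: 'n::{finite,linorder} set) (\<lambda>_. {0..2 * pi}) | Pi\<^sub>M UNIV (\<lambda>_. lborel).
      (\<Prod>i\<in>UNIV. of_real c * jacobi_theta (\<theta> i / 2) s) * of_real (\<Prod>i\<in>UNIV. \<Prod>j\<in>{j. i < j}.
        (cmod (exp (\<i> * of_real (\<theta> i)) - exp (\<i> * of_real (\<theta> j))))\<^sup>2)) =
    of_real (c ^ CARD('n) * fact CARD('n) * (2 * pi) ^ CARD('n) *
      (\<Prod>k = 1..CARD('n) - 1. (1 - exp (- real k * (2 * s))) ^ (CARD('n) - k)))"
    (is "set_lebesgue_integral ?M ?A ?f = _")
proof -
  interpret product_sigma_finite "\<lambda>_::'n. lborel :: real measure" ..
  let ?P = "{p. p permutes (UNIV :: 'n set)}"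
  let ?E = "\<lambda>t::real. exp (\<i> * of_real t)"
  let ?w = "\<lambda>p r \<theta>. \<Prod>i\<in>UNIV. weighted_monomial s (rk (p i)) (rk (r i)) (\<theta> i)"
  have expand: "indicator ?A \<theta> *\<^sub>R ?f \<theta> =
      (\<Sum>p\<in>?P. \<Sum>r\<in>?P. of_real (c ^ CARD('n)) * (of_int (sign p) * of_int (sign r) * ?w p r \<theta>))" for \<theta>
  proof -
    have ind: "complex_of_real (indicator ?A \<theta>) = (\<Prod>i\<in>UNIV. of_real (indicator {0..2 * pi} (\<theta> i)))"
      by (auto simp: indicator_def PiE_def Pi_def prod_zero)
    have w: "?w p r \<theta> = of_real (indicator ?A \<theta>) * (\<Prod>i\<in>UNIV. jacobi_theta (\<theta> i / 2) s) *
        ((\<Prod>i\<in>UNIV. ?E (\<theta> i) ^ rk (p i)) * (\<Prod>i\<in>UNIV. cnj (?E (\<theta> i)) ^ rk (r i)))" for p r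
      unfolding ind weighted_monomial_def
      by (simp add: scaleR_conv_of_real mult.assoc flip: prod.distrib)
    have "indicator ?A \<theta> *\<^sub>R ?f \<theta> = of_real (c ^ CARD('n)) * (of_real (indicator ?A \<theta>) *
        (\<Prod>i\<in>UNIV. jacobi_theta (\<theta> i / 2) s)) *
        ((\<Sum>p\<in>?P. of_int (sign p) * (\<Prod>i\<in>UNIV. ?E (\<theta> i) ^ rk (p i))) *
         (\<Sum>r\<in>?P. of_int (sign r) * (\<Prod>i\<in>UNIV. cnj (?E (\<theta> i)) ^ rk (r i))))"
      unfolding prod_dist_eq_Vandermonde
      by (simp add: det_def scaleR_conv_of_real prod.distrib mult_ac)
    then show ?thesis
      unfolding w sum_product by (simp add: sum_distrib_left mult_ac)
  qed
  have int: "integrable ?M (?w p r)" for p r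
    by (intro product_integrable_prod) (simp_all add: integrable_weighted_monomial s)
  \<comment> \<open>Fubini separates the angles; angle i contributes 2 pi times the Gaussian
    Toeplitz entry at (p i, r i).\<close>
  have lint: "(LINT \<theta>|?M. ?w p r \<theta>) = (\<Prod>i\<in>UNIV. of_real (2 * pi * exp (- (real (rk (p i)) - real (rk (r i)))\<^sup>2 * s)))" for p r
    by (subst product_integral_prod) (simp_all add: integrable_weighted_monomial integral_weighted_monomial s)
  have "set_lebesgue_integral ?M ?A ?f =
      (\<Sum>p\<in>?P. \<Sum>r\<in>?P. of_real (c ^ CARD('n)) * (of_int (sign p) * of_int (sign r) * (LINT \<theta>|?M. ?w p r \<theta>)))"
    unfolding set_lebesgue_integral_def expand
    by (simp add: int)
  also have "\<dots> = of_real (c ^ CARD('n) * (2 * pi) ^ CARD('n) * (\<Sum>p\<in>?P. \<Sum>r\<in>?P. of_int (sign p) * of_int (sign r) *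
      (\<Prod>i\<in>UNIV. exp (- (real (rk (p i)) - real (rk (r i)))\<^sup>2 * s))))"
    unfolding lint by (simp add: prod.distrib sum_distrib_left mult_ac)
  also have "(\<Sum>p\<in>?P. \<Sum>r\<in>?P. of_int (sign p) * of_int (sign r) *
      (\<Prod>i\<in>UNIV. exp (- (real (rk (p i)) - real (rk (r i)))\<^sup>2 * s))) =
      fact CARD('n) * (\<Prod>k = 1..CARD('n) - 1. (1 - exp (- real k * (2 * s))) ^ (CARD('n) - k))"
    unfolding det_gaussian_Toeplitz[symmetric]
    by (rule sum_sign_sign_prod[where c = "\<lambda>a b. exp (- (real (rk a) - real (rk b))\<^sup>2 * s)"])
  finally show ?thesis by (simp add: mult_ac)
qed

section \<open>The normalising constant on the unitary group and the quotient\<close>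

theorem proposition8:
  fixes vol :: "(complex^('n::{finite,linorder})^('n::{finite,linorder})) measure"
    and xbar :: "complex^('n::{finite,linorder})^('n::{finite,linorder})" and \<omega> \<sigma> :: real
  assumes "\<omega> > 0"
    and "\<sigma> > 0"
    and "invariant_volume \<omega> vol"
    and "xbar \<in> unitary_group"
  shows "of_real (Z_M CARD('n) \<omega> \<sigma>) / Z_dual vol xbar \<sigma> =
    of_real (exp ((real CARD('n) ^ 3 - real CARD('n)) / 6 * \<sigma>\<^sup>2))"
proof -
  let ?N = "CARD('n)"
  define c where "c = sqrt (2 * pi * \<sigma>\<^sup>2)"
  define g where "g x = det (c *\<^sub>R Theta x (\<sigma>\<^sup>2))" for x :: "complex^('n::{finite,linorder})^('n::{finite,linorder})"
  define Q where "Q = (\<Prod>k = 1..?N - 1. (1 - exp (- real k * \<sigma>\<^sup>2)) ^ (?N - k))"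
  have \<sigma>2: "\<sigma>\<^sup>2 > 0" using assms(2) by simp
  have sets: "sets vol = sets (restrict_space borel unitary_group)"
    and fin: "finite_measure vol"
    and inv: "distr vol vol (\<lambda>x. x ** adj xbar) = vol"
    and weyl: "weyl_integral_formula \<omega> vol"
    using assms(3) adj_in_unitary_group[OF assms(4)] by (auto simp: invariant_volume_def)
  have space: "space vol = unitary_group"
    using sets_eq_imp_space_eq[OF sets] by (simp add: space_restrict_space)
  have gm: "g \<in> borel_measurable vol"
    unfolding g_def measurable_cong_sets[OF sets refl] by (rule det_Theta_measurable[OF \<sigma>2])
  have gi: "integrable vol g"
    using norm_det_Theta_le[OF \<sigma>2, of _ c] gm
    by (intro finite_measure.integrable_const_bound[OF fin, where B = "(\<bar>c\<bar> * theta_const (\<sigma>\<^sup>2 / 2)) ^ ?N"] AE_I2)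
      (auto simp: g_def space)
  have shift: "(\<lambda>x. x ** adj xbar) \<in> measurable vol vol"
  proof -
    have "(\<lambda>x. x ** adj xbar) \<in> measurable (restrict_space borel unitary_group) (restrict_space borel unitary_group)"
    proof (rule measurable_restrict_space3)
      have "continuous_on UNIV (\<lambda>x. x ** adj xbar)"
        unfolding matrix_matrix_mult_def by (intro continuous_intros)
      then show "(\<lambda>x. x ** adj xbar) \<in> borel_measurable borel"
        by (rule borel_measurable_continuous_onI)
    qed (auto intro!: mult_in_unitary_group adj_in_unitary_group assms)
    then show ?thesis by (simp add: measurable_cong_sets[OF sets sets])
  qed
  have "Z_dual vol xbar \<sigma> = (LINT x|vol. g (x ** adj xbar))"
    by (simp add: Z_dual_def f_star_def g_def c_def)
  also have "\<dots> = (LINT x|distr vol vol (\<lambda>x. x ** adj xbar). g x)"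
    by (rule integral_distr[OF shift gm, symmetric])
  also have "\<dots> = (LINT x|vol. g x)"
    by (simp only: inv)
  \<comment> \<open>On a diagonalization \<open>g\<close> is a product over the eigenvalues in which
    \<open>k\<close> no longer occurs, as the Weyl formula requires of \<open>F\<close>.\<close>
  also have "\<dots> = of_real (\<omega> / (2 ^ (?N\<^sup>2) * fact ?N * (2 * pi) ^ ?N)) *
      (LINT \<theta> : PiE UNIV (\<lambda>_. {0..2 * pi}) | Pi\<^sub>M UNIV (\<lambda>_. lborel).
        (\<Prod>i\<in>UNIV. of_real c * jacobi_theta (\<theta> i / 2) (\<sigma>\<^sup>2 / 2)) *
        of_real (\<Prod>i\<in>(UNIV :: 'n set). \<Prod>j\<in>{j. i < j}.
          (cmod (exp (\<i> * of_real (\<theta> i)) - exp (\<i> * of_real (\<theta> j))))\<^sup>2))"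
    by (rule weyl[unfolded weyl_integral_formula_def, THEN spec, THEN spec, THEN mp, OF gi, THEN mp])
      (simp add: g_def Theta_conj_diag det_conj_diag)
  also have "\<dots> = of_real (\<omega> / 2 ^ (?N\<^sup>2) * c ^ ?N * Q)"
    using \<sigma>2 by (subst weyl_integral_theta) (simp_all add: Q_def)
  finally have dual: "Z_dual vol xbar \<sigma> = of_real (\<omega> / 2 ^ (?N\<^sup>2) * c ^ ?N * Q)" .
  have pos: "2 * pi * \<sigma>\<^sup>2 > 0" using \<sigma>2 by simp
  then have "c ^ ?N = (2 * pi * \<sigma>\<^sup>2) powr (real ?N / 2)"
    using powr_power[of "2 * pi * \<sigma>\<^sup>2" "1 / 2" ?N] assms(2)
    by (simp add: c_def powr_half_sqrt)
  then have "Z_M ?N \<omega> \<sigma> = \<omega> / 2 ^ (?N\<^sup>2) * c ^ ?N * Q * exp ((real ?N ^ 3 - real ?N) / 6 * \<sigma>\<^sup>2)"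
    by (simp add: Z_M_def Q_def)
  \<comment> \<open>Every factor of \<open>Q\<close> is positive, since exp (-k s) < 1 for k >= 1
    and s > 0, so the common factor cancels and only the exponential remains.\<close>
  moreover have "\<omega> / 2 ^ (?N\<^sup>2) * c ^ ?N * Q \<noteq> 0"
    using assms(1) pos \<sigma>2 by (auto simp: Q_def c_def)
  ultimately show ?thesis
    unfolding dual by (simp del: of_real_mult of_real_divide of_real_power flip: of_real_divide)
qed

end
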